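(* Let $u,v\in\mathcal{M}$. The following seven statements are equivalent: (S1) $\phi(u)=\phi(v)$ in $\mathcal{W}$; (S2) $\phi(u)$ and $\phi(v)$ act equally on $\Bbbk[x]$, i.e. $(\phi(u))(p)=(\phi(v))(p)$ for every $p\in\Bbbk[x]$; (S3) $u$ and $v$ have the same final height and $H_{NE}(u,z)=H_{NE}(v,z)$; (S3') $u$ and $v$ have the same final height and $H_{SE}(u,z)=H_{SE}(v,z)$; (S4) $u$ and $v$ have the same final height and $H(u,z)=H(v,z)$; (S5) $u\overset{\mathrm{bal}}{\sim} v$; (S6) $u\overset{\mathrm{flip}}{\sim} v$.
   Context: $\Bbbk$ is a field of characteristic $0$. $\mathcal{M}$ is the free monoid on two letters $D,U$ (elements are called words). $\mathcal{W}=\Bbbk\langle D,U\mid DU-UD=1\rangle$ is the Weyl algebra; it acts on $\Bbbk[x]$ with $D$ acting as $d/dx$ and $U$ as multiplication by $x$. $\phi:\mathcal{M}\to\mathcal{W}$ is the monoid morphism sending $D\mapsto D$, $U\mapsto U$. For a word $w=w_1\cdots w_N$ and $0\le i\le N$ let $h_i=(\#U\text{'s in }w_1\cdots w_i)-(\#D\text{'s in }w_1\cdots w_i)$ (the height of the $i$-th vertex of the lattice path starting at $(0,0)$ taking a step $(1,1)$ for each $U$ and $(1,-1)$ for each $D$). The final height of $w$ is $h_N$. Define Laurent polynomials $H(w,z)=\sum_{i=0}^{N} z^{h_i}$, $H_{NE}(w,z)=\sum_{0\le i<N,\ w_{i+1}=U} z^{h_i}$, $H_{SE}(w,z)=\sum_{0\le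 i<N,\ w_{i+1}=D} z^{h_i}$. A word is balanced if it has as many $D$'s as $U$'s. $\omega:\mathcal{M}\to\mathcal{M}$ is the monoid anti-morphism with $\omega(U)=D$, $\omega(D)=U$ (reverse the word and swap each letter). A balanced commutation turns a word $pyxq$ into $pxyq$ where $p,q$ are words and $x,y$ are balanced words; $\overset{\mathrm{bal}}{\sim}$ is the equivalence relation "obtainable by a finite (possibly empty) sequence of balanced commutations". A balanced flip turns $p\,\omega(x)\,q$ into $pxq$ for words $p,q$ and a balanced word $x$; $\overset{\mathrm{flip}}{\sim}$ is the equivalence relation "obtainable by a finite sequence of balanced flips". *)

theory Defs
  imports "HOL-Library.Poly_Mapping" "HOL-Computational_Algebra.Polynomial"
begin

section \<open>Words\<close>

datatype letter = D | U

type_synonym word = "letter list"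

text \<open>
  Poly_Mapping forms monoid algebras over an additively written monoid of keys, so
  lists (the free monoid) are equipped with concatenation as their addition.
\<close>

instantiation list :: (type) monoid_add
begin

definition zero_list :: "'a list" where "zero_list = []"

definition plus_list :: "'a list \<Rightarrow> 'a list \<Rightarrow> 'a list" where "plus_list = (@)"

instance
  by standard (simp_all add: zero_list_def plus_list_def)

end

definition height :: "word \<Rightarrow> nat \<Rightarrow> int" where
  "height w i = int (count_list (take i w) U) - int (count_list (take i w) D)"

definition final_height :: "word \<Rightarrow> int" where
  "final_height w = height w (length w)"

definition balanced :: "word \<Rightarrow> bool" where
  "balanced w \<longleftrightarrow> count_list w D = count_list w U"

text \<open>
  Laurent polynomials over the integers are the group ring of the additive group of
  integers: \<open>Poly_Mapping.single k c\<close> is the monomial with coefficient c and exponent k.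
\<close>

type_synonym laurent = "int \<Rightarrow>\<^sub>0 int"

definition H :: "word \<Rightarrow> laurent" where
  "H w = (\<Sum>i\<le>length w. Poly_Mapping.single (height w i) 1)"

definition H_NE :: "word \<Rightarrow> laurent" where
  "H_NE w = (\<Sum>i | i < length w \<and> w ! i = U. Poly_Mapping.single (height w i) 1)"

definition H_SE :: "word \<Rightarrow> laurent" where
  "H_SE w = (\<Sum>i | i < length w \<and> w ! i = D. Poly_Mapping.single (height w i) 1)"

fun swap_letter :: "letter \<Rightarrow> letter" where
  "swap_letter U = D"
| "swap_letter D = U"

definition omega :: "word \<Rightarrow> word" where
  "omega w = rev (map swap_letter w)"

inductive bal_step :: "word \<Rightarrow> word \<Rightarrow> bool" where
  "balanced x \<Longrightarrow> balanced y \<Longrightarrow> bal_step (p @ y @ x @ q) (p @ x @ y @ q)"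

inductive flip_step :: "word \<Rightarrow> word \<Rightarrow> bool" where
  "balanced x \<Longrightarrow> flip_step (p @ omega x @ q) (p @ x @ q)"

text \<open>
  Both step relations are symmetric (see below), so their reflexive transitive closures
  are equivalence relations.
\<close>

definition bal_equiv :: "word \<Rightarrow> word \<Rightarrow> bool" where
  "bal_equiv = bal_step\<^sup>*\<^sup>*"

definition flip_equiv :: "word \<Rightarrow> word \<Rightarrow> bool" where
  "flip_equiv = flip_step\<^sup>*\<^sup>*"

lemma balanced_omega [simp]: "balanced (omega w) \<longleftrightarrow> balanced w"
proof -
  have "count_list (map swap_letter w) D = count_list w U \<and>
        count_list (map swap_letter w) U = count_list w D"
  proof (induction w)
    case (Cons a w)
    then show ?case by (cases a) auto
  qed simp
  then show ?thesis by (auto simp: balanced_def omega_def)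
qed

lemma omega_omega [simp]: "omega (omega w) = w"
proof -
  have "swap_letter (swap_letter a) = a" for a by (cases a) auto
  then show ?thesis by (simp add: omega_def rev_map o_def)
qed

lemma bal_step_sym: "bal_step u v \<Longrightarrow> bal_step v u"
  by (auto elim!: bal_step.cases intro: bal_step.intros)

lemma flip_step_sym: "flip_step u v \<Longrightarrow> flip_step v u"
  by (erule flip_step.cases) (metis balanced_omega flip_step.intros omega_omega)

lemma equivp_bal_equiv: "equivp bal_equiv"
proof -
  have "symp bal_step" by (rule sympI) (rule bal_step_sym)
  then show ?thesis
    unfolding bal_equiv_def by (intro equivpI) (auto simp: reflp_def intro: symp_rtranclp)
qed

lemma equivp_flip_equiv: "equivp flip_equiv"
proof -
  have "symp flip_step" by (rule sympI) (rule flip_step_sym)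
  then show ?thesis
    unfolding flip_equiv_def by (intro equivpI) (auto simp: reflp_def intro: symp_rtranclp)
qed


section \<open>The free algebra and its action on polynomials\<close>

type_synonym 'k free_alg = "word \<Rightarrow>\<^sub>0 'k"

definition free_gen :: "letter \<Rightarrow> 'k::field free_alg" where
  "free_gen a = Poly_Mapping.single [a] 1"

fun letter_act :: "letter \<Rightarrow> 'k::field poly \<Rightarrow> 'k poly" where
  "letter_act D p = pderiv p"
| "letter_act U p = [:0, 1:] * p"

text \<open>A word acts as the composition of its letters, the last letter being applied first.\<close>

definition word_act :: "word \<Rightarrow> 'k::field poly \<Rightarrow> 'k poly" where
  "word_act w p = foldr letter_act w p"

definition free_act :: "'k::field free_alg \<Rightarrow> 'k poly \<Rightarrow> 'k poly" where
  "free_act f p = (\<Sum>w\<in>Poly_Mapping.keys f. smult (Poly_Mapping.lookup f w) (word_act w p))"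

lemma free_act_superset:
  assumes "finite A" "Poly_Mapping.keys f \<subseteq> A"
  shows "free_act f p = (\<Sum>w\<in>A. smult (Poly_Mapping.lookup f w) (word_act w p))"
  unfolding free_act_def using assms
  by (intro sum.mono_neutral_left) (auto simp: in_keys_iff)

lemma free_act_0 [simp]: "free_act 0 p = 0"
  by (simp add: free_act_def)

lemma free_act_single: "free_act (Poly_Mapping.single w c) p = smult c (word_act w p)"
  by (subst free_act_superset[of "{w}"]) auto

lemma free_act_add: "free_act (f + g) p = free_act f p + free_act g p"
proof -
  let ?A = "Poly_Mapping.keys f \<union> Poly_Mapping.keys g"
  have "free_act (f + g) p =
      (\<Sum>w\<in>?A. smult (Poly_Mapping.lookup (f + g) w) (word_act w p))"
    by (intro free_act_superset) (simp_all add: Poly_Mapping.keys_add)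
  also have "\<dots> = free_act f p + free_act g p"
    by (simp add: free_act_superset[of ?A] lookup_add smult_add_left sum.distrib)
  finally show ?thesis .
qed

lemma free_act_diff: "free_act (f - g) p = free_act f p - free_act g p"
  using free_act_add[of "f - g" g p] by simp

lemma free_act_sum: "free_act (\<Sum>i\<in>A. f i) p = (\<Sum>i\<in>A. free_act (f i) p)"
  by (induction A rule: infinite_finite_induct) (auto simp: free_act_add)

lemma free_alg_monomials:
  "f = (\<Sum>w\<in>Poly_Mapping.keys f. Poly_Mapping.single w (Poly_Mapping.lookup f w))"
  by (rule poly_mapping_eqI)
     (simp add: lookup_sum lookup_single when_def in_keys_iff sum.delta)

lemma smult_sum_right: "smult c (\<Sum>i\<in>A. f i) = (\<Sum>i\<in>A. smult c (f i))"
  by (induction A rule: infinite_finite_induct) (auto simp: smult_add_right)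

lemma letter_act_linear:
  "letter_act a (p + q) = letter_act a p + letter_act a q"
  "letter_act a (smult c p) = smult c (letter_act a p)"
  "letter_act a 0 = 0"
  by (cases a; simp add: pderiv_add pderiv_smult distrib_left)+

lemma word_act_linear:
  "word_act w (p + q) = word_act w p + word_act w q"
  "word_act w (smult c p) = smult c (word_act w p)"
  "word_act w 0 = 0"
  by (induction w) (auto simp: word_act_def letter_act_linear)

lemma word_act_sum: "word_act w (\<Sum>i\<in>A. f i) = (\<Sum>i\<in>A. word_act w (f i))"
  by (induction A rule: infinite_finite_induct) (auto simp: word_act_linear)

lemma word_act_append: "word_act (v @ w) p = word_act v (word_act w p)"
  by (simp add: word_act_def)

lemma free_act_linear:
  "free_act f (p + q) = free_act f p + free_act f q"
  "free_act f (smult c p) = smult c (free_act f p)"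
  "free_act f 0 = 0"
  by (simp_all add: free_act_def word_act_linear smult_add_right sum.distrib
      smult_sum_right mult.commute)

lemma free_act_1 [simp]: "free_act 1 p = p"
  by (simp add: single_one[symmetric] free_act_single word_act_def zero_list_def
      del: single_one)

lemma free_act_mult: "free_act (f * g) p = free_act f (free_act g p)"
proof -
  have "free_act (f * g) p =
      (\<Sum>v\<in>Poly_Mapping.keys f. \<Sum>w\<in>Poly_Mapping.keys g.
        free_act (Poly_Mapping.single v (Poly_Mapping.lookup f v) *
                  Poly_Mapping.single w (Poly_Mapping.lookup g w)) p)"
    by (subst (1) free_alg_monomials[of f], subst (1) free_alg_monomials[of g])
       (simp add: sum_product free_act_sum)
  also have "\<dots> = free_act f (free_act g p)"
    by (simp add: mult_single free_act_single plus_list_def word_act_append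
        free_act_def[of f] free_act_def[of g] word_act_sum word_act_linear smult_sum_right)
  finally show ?thesis .
qed


section \<open>The Weyl algebra\<close>

definition weyl_relator :: "'k::field free_alg" where
  "weyl_relator = free_gen D * free_gen U - free_gen U * free_gen D - 1"

text \<open>
  The two-sided ideal generated by the relator consists of the finite sums of elements
  \<open>f * weyl_relator * g\<close>; signs and scalars are absorbed into f.
\<close>

inductive_set weyl_ideal :: "'k::field free_alg set" where
  zero: "0 \<in> weyl_ideal"
| gen: "f * weyl_relator * g \<in> weyl_ideal"
| add: "f \<in> weyl_ideal \<Longrightarrow> g \<in> weyl_ideal \<Longrightarrow> f + g \<in> weyl_ideal"

lemma weyl_ideal_mult:
  assumes "f \<in> weyl_ideal"
  shows "g * f \<in> weyl_ideal" "f * g \<in> weyl_ideal"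
proof -
  from assms show "g * f \<in> weyl_ideal"
  proof induction
    case (gen f h)
    then show ?case using weyl_ideal.gen[of "g * f" h] by (simp add: mult.assoc)
  qed (auto simp: distrib_left intro: weyl_ideal.intros)
  from assms show "f * g \<in> weyl_ideal"
  proof induction
    case (gen f h)
    then show ?case using weyl_ideal.gen[of f "h * g"] by (simp add: mult.assoc)
  qed (auto simp: distrib_right intro: weyl_ideal.intros)
qed

lemma weyl_ideal_uminus: "f \<in> weyl_ideal \<Longrightarrow> - f \<in> weyl_ideal"
  using weyl_ideal_mult(1)[of f "- 1"] by simp

lemma free_act_weyl_ideal:
  assumes "f \<in> weyl_ideal"
  shows "free_act f p = 0"
  using assms
proof (induction arbitrary: p)
  case (gen f g)
  have "free_act weyl_relator q = 0" for q :: "'a poly"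
    by (simp add: weyl_relator_def free_gen_def free_act_diff free_act_mult free_act_single
        word_act_def pderiv_mult pderiv_pCons)
  then show ?case by (simp add: free_act_mult free_act_linear)
qed (simp_all add: free_act_add)

definition weyl_rel :: "'k::field free_alg \<Rightarrow> 'k free_alg \<Rightarrow> bool" where
  "weyl_rel f g \<longleftrightarrow> f - g \<in> weyl_ideal"

lemma equivp_weyl_rel: "equivp weyl_rel"
proof (rule equivpI)
  show "reflp weyl_rel"
    by (rule reflpI) (simp add: weyl_rel_def weyl_ideal.zero)
  show "symp weyl_rel"
    unfolding weyl_rel_def by (rule sympI) (metis minus_diff_eq weyl_ideal_uminus)
  show "transp weyl_rel"
    unfolding weyl_rel_def by (rule transpI) (drule (1) weyl_ideal.add, simp)
qed

quotient_type (overloaded) 'k weyl = "'k::field free_alg" / weyl_rel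
  by (rule equivp_weyl_rel)

instantiation weyl :: (field) ring_1
begin

lift_definition zero_weyl :: "'a weyl" is 0 .

lift_definition one_weyl :: "'a weyl" is 1 .

lift_definition plus_weyl :: "'a weyl \<Rightarrow> 'a weyl \<Rightarrow> 'a weyl" is "(+)"
  unfolding weyl_rel_def by (simp only: add_diff_add weyl_ideal.add)

lift_definition uminus_weyl :: "'a weyl \<Rightarrow> 'a weyl" is uminus
  unfolding weyl_rel_def by (drule weyl_ideal_uminus) simp

lift_definition minus_weyl :: "'a weyl \<Rightarrow> 'a weyl \<Rightarrow> 'a weyl" is "(-)"
  unfolding weyl_rel_def
  subgoal for f f' g g'
    using weyl_ideal.add[OF _ weyl_ideal_uminus, of "f - f'" "g - g'"]
    by (simp add: algebra_simps)
  done

lift_definition times_weyl :: "'a weyl \<Rightarrow> 'a weyl \<Rightarrow> 'a weyl" is "(*)"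
  unfolding weyl_rel_def
  subgoal for f f' g g'
    using weyl_ideal.add[OF weyl_ideal_mult(2)[of "f - f'" g] weyl_ideal_mult(1)[of "g - g'" f']]
    by (simp add: algebra_simps)
  done

instance
proof
  show "(0 :: 'a weyl) \<noteq> 1"
  proof transfer
    have False if "(- 1 :: 'a free_alg) \<in> weyl_ideal"
      using free_act_weyl_ideal[OF weyl_ideal_uminus[OF that], of 1] by simp
    then show "\<not> weyl_rel (0 :: 'a free_alg) 1"
      by (auto simp: weyl_rel_def)
  qed
qed (transfer; simp add: weyl_rel_def weyl_ideal.zero algebra_simps)+

end

lift_definition weyl_const :: "'k::field \<Rightarrow> 'k weyl" is "Poly_Mapping.single []" .

lift_definition weyl_gen :: "letter \<Rightarrow> 'k::field weyl" is free_gen .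

lift_definition weyl_act :: "'k::field weyl \<Rightarrow> 'k poly \<Rightarrow> 'k poly" is free_act
  unfolding weyl_rel_def
  by (rule ext) (metis free_act_diff free_act_weyl_ideal right_minus_eq)

definition phi :: "word \<Rightarrow> 'k::field weyl" where
  "phi w = prod_list (map weyl_gen w)"

lemma phi_Nil: "phi [] = 1"
  and phi_append: "phi (v @ w) = phi v * phi w"
  and phi_letter: "phi [a] = weyl_gen a"
  by (simp_all add: phi_def)

lemma weyl_commutation: "weyl_gen D * weyl_gen U - weyl_gen U * weyl_gen D = (1 :: 'k::field weyl)"
proof transfer
  show "weyl_rel (free_gen D * free_gen U - free_gen U * free_gen D) (1 :: 'k free_alg)"
    using weyl_ideal.gen[of 1 1] by (simp add: weyl_rel_def weyl_relator_def)
qed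

lemma weyl_act_add: "weyl_act (a + b) p = weyl_act a p + weyl_act b p"
  by transfer (rule free_act_add)

lemma weyl_act_mult: "weyl_act (a * b) p = weyl_act a (weyl_act b p)"
  by transfer (rule free_act_mult)

lemma weyl_act_1: "weyl_act 1 p = p"
  by transfer simp

lemma weyl_act_const: "weyl_act (weyl_const c) p = smult c p"
  by transfer (simp add: free_act_single word_act_def)

lemma weyl_act_D: "weyl_act (weyl_gen D) p = pderiv p"
  by transfer (simp add: free_gen_def free_act_single word_act_def)

lemma weyl_act_U: "weyl_act (weyl_gen U) p = [:0, 1:] * p"
  by transfer (simp add: free_gen_def free_act_single word_act_def)

end

theory Submission
  imports Defs
begin

text \<open>
  Everything is read off the numbers of up and down steps of a path starting at each height.
  The final height determines how often each level is crossed upwards minus downwards, so the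
  up counts, the down counts and the vertex counts determine each other. The word \<open>w\<close> sends
  \<open>x ^ n\<close> to a multiple of a monomial, and the factor, as a polynomial in \<open>n\<close>, has its roots
  at the heights of the down steps. If two words with the same counts start with different
  letters, then one of the two paths takes a step in the other direction from height 0 and comes
  back to height 0 afterwards; a balanced commutation makes its first letter agree with that
  of the other word. Finally, balanced words act through the commutative subring generated
  by \<open>U D\<close>, and reversing a balanced path visits the same vertices.
\<close>

section \<open>Heights and step counts\<close>

fun slope :: "letter \<Rightarrow> int" where
  "slope U = 1"
| "slope D = -1"

lemma letter_neq_iff: "a \<noteq> b \<longleftrightarrow> a = swap_letter b"
  by (cases a; cases b) auto

lemma slope_swap_letter [simp]: "slope (swap_letter a) = - slope a"
  by (cases a) auto

lemma height_eq_final_height: "height w i = final_height (take i w)"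
  by (cases "i \<le> length w") (simp_all add: height_def final_height_def min_def)

lemma final_height_Nil [simp]: "final_height [] = 0"
  by (simp add: final_height_def height_def)

lemma final_height_Cons [simp]: "final_height (a # w) = slope a + final_height w"
  by (cases a) (auto simp: final_height_def height_def)

lemma final_height_append [simp]: "final_height (v @ w) = final_height v + final_height w"
  by (induction v) auto

lemma final_height_omega [simp]: "final_height (omega w) = - final_height w"
  by (induction w) (auto simp: omega_def)

lemma balanced_iff_final_height: "balanced w \<longleftrightarrow> final_height w = 0"
  by (auto simp: balanced_def final_height_def height_def)

lemma abs_final_height_le: "\<bar>final_height w\<bar> \<le> int (length w)"
proof (induction w)
  case (Cons a w)
  then show ?case by (cases a) auto
qed simp

lemma height_Suc: "i < length w \<Longrightarrow> height w (Suc i) = height w i + slope (w ! i)"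
  by (simp add: height_eq_final_height take_Suc_conv_app_nth)

text \<open>A sum of indicators instead of a cardinality: shifting the summation index yields the
  recursion on \<open>#\<close>.\<close>

definition steps :: "letter \<Rightarrow> word \<Rightarrow> int \<Rightarrow> nat" where
  "steps a w k = (\<Sum>i<length w. of_bool (w ! i = a \<and> height w i = k))"

lemma steps_Nil [simp]: "steps a [] k = 0"
  by (simp add: steps_def)

lemma steps_Cons [simp]:
  "steps a (b # w) k = of_bool (a = b \<and> k = 0) + steps a w (k - slope b)"
proof -
  have "height (b # w) (Suc i) = k \<longleftrightarrow> height w i = k - slope b" for i
    by (auto simp: height_eq_final_height)
  moreover have "height (b # w) 0 = k \<longleftrightarrow> k = 0"
    by (auto simp: height_eq_final_height)
  ultimately show ?thesis
    by (auto simp: steps_def sum.lessThan_Suc_shift simp del: sum.lessThan_Suc sum_of_bool_eq)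
qed

lemma steps_append: "steps a (v @ w) k = steps a v k + steps a w (k - final_height v)"
  by (induction v arbitrary: k) (auto simp: algebra_simps)

lemma steps_posD:
  assumes "steps a w k > 0"
  obtains i where "i < length w" "w ! i = a" "height w i = k"
  using assms unfolding steps_def by (auto simp: card_gt_0_iff)

lemma steps_eq_0: "k < - int (length w) \<Longrightarrow> steps a w k = 0"
proof (induction w arbitrary: k)
  case (Cons b w)
  then show ?case by (cases b) auto
qed simp

text \<open>\<open>omega w\<close> runs through the path of \<open>w\<close> backwards, translated
  so that it starts at 0. Each step is traversed from its other end, which accounts for the shifts
  by \<open>slope a\<close> and by the final height.\<close>

lemma steps_omega: "steps a (omega w) k = steps (swap_letter a) w (k + slope a + final_height w)"
proof (induction w)
  case (Cons b w)
  have "omega (b # w) = omega w @ [swap_letter b]"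
    by (simp add: omega_def)
  then show ?case using Cons
    by (cases a; cases b) (auto simp: steps_append algebra_simps)
qed (simp add: omega_def)

text \<open>Both counts concern the gap between \<open>k\<close> and \<open>k + 1\<close>. Upward
  and downward crossings of a gap alternate, so their difference depends only on the sides on which
  the path starts and ends.\<close>

lemma steps_U_minus_steps_D:
  "int (steps U w k) - int (steps D w (k + 1)) =
     of_bool (0 \<le> k \<and> k < final_height w) - of_bool (final_height w \<le> k \<and> k < 0)"
proof (induction w arbitrary: k)
  case (Cons a w)
  show ?case
  proof (cases a)
    case U
    then show ?thesis using Cons[of "k - 1"] by (auto split: if_splits)
  next
    case D
    then show ?thesis using Cons[of "k + 1"] by (auto split: if_splits)
  qed
qed simp

section \<open>Coefficients of the Laurent polynomials as step counts\<close>

lemma lookup_sum_single: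
  "finite A \<Longrightarrow> Poly_Mapping.lookup (\<Sum>i\<in>A. Poly_Mapping.single (f i) (1::int)) k
     = (\<Sum>i\<in>A. of_bool (f i = k))"
  unfolding lookup_sum lookup_single when_def of_bool_def by (intro sum.cong) auto

lemma lookup_H_NE: "Poly_Mapping.lookup (H_NE w) k = int (steps U w k)"
proof -
  have "Poly_Mapping.lookup (H_NE w) k = (\<Sum>i | i \<in> {..<length w} \<and> w ! i = U. of_bool (height w i = k))"
    by (simp add: H_NE_def lookup_sum_single)
  also have "\<dots> = int (steps U w k)"
    by (subst sum.inter_filter) (auto simp: steps_def simp del: sum_of_bool_eq intro!: sum.cong)
  finally show ?thesis .
qed

lemma lookup_H_SE: "Poly_Mapping.lookup (H_SE w) k = int (steps D w k)"
proof -
  have "Poly_Mapping.lookup (H_SE w) k = (\<Sum>i | i \<in> {..<length w} \<and> w ! i = D. of_bool (height w i = k))"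
    by (simp add: H_SE_def lookup_sum_single)
  also have "\<dots> = int (steps D w k)"
    by (subst sum.inter_filter) (auto simp: steps_def simp del: sum_of_bool_eq intro!: sum.cong)
  finally show ?thesis .
qed

text \<open>Every vertex except the last is the start of exactly one step; the last one gives the
  extra term.\<close>

lemma lookup_H:
  "Poly_Mapping.lookup (H w) k = int (steps U w k) + int (steps D w k) + of_bool (final_height w = k)"
proof -
  have split: "of_bool (height w i = k) =
      (of_bool (w ! i = U \<and> height w i = k) + of_bool (w ! i = D \<and> height w i = k) :: int)" for i
    by (cases "w ! i") auto
  have "Poly_Mapping.lookup (H w) k =
      (\<Sum>i<length w. of_bool (height w i = k)) + of_bool (final_height w = k)"
    unfolding H_def final_height_def
    by (subst lookup_sum_single) (simp_all del: sum_of_bool_eq flip: lessThan_Suc_atMost)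
  also have "(\<Sum>i<length w. of_bool (height w i = k)) = int (steps U w k) + int (steps D w k)"
    by (subst split) (simp add: steps_def sum.distrib del: sum_of_bool_eq)
  finally show ?thesis .
qed

lemma H_NE_eq_iff: "H_NE u = H_NE v \<longleftrightarrow> (\<forall>k. steps U u k = steps U v k)"
  by (simp add: poly_mapping_eq_iff fun_eq_iff lookup_H_NE)

lemma H_SE_eq_iff: "H_SE u = H_SE v \<longleftrightarrow> (\<forall>k. steps D u k = steps D v k)"
  by (simp add: poly_mapping_eq_iff fun_eq_iff lookup_H_SE)

lemma H_NE_eq_iff_H_SE_eq:
  assumes "final_height u = final_height v"
  shows "H_NE u = H_NE v \<longleftrightarrow> H_SE u = H_SE v"
proof -
  have *: "int (steps U u k) - int (steps D u (k + 1)) = int (steps U v k) - int (steps D v (k + 1))" for k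
    using assms by (simp add: steps_U_minus_steps_D)
  show ?thesis
    unfolding H_NE_eq_iff H_SE_eq_iff
  proof safe
    fix k assume "\<forall>k. steps U u k = steps U v k"
    then show "steps D u k = steps D v k" using *[of "k - 1"] by simp
  next
    fix k assume "\<forall>k. steps D u k = steps D v k"
    then show "steps U u k = steps U v k" using *[of k] by simp
  qed
qed

lemma H_NE_eq_iff_H_eq:
  assumes "final_height u = final_height v"
  shows "H_NE u = H_NE v \<longleftrightarrow> H u = H v"
proof
  assume NE: "H_NE u = H_NE v"
  then have "H_SE u = H_SE v"
    using H_NE_eq_iff_H_SE_eq[OF assms] by simp
  with NE assms show "H u = H v"
    by (simp add: poly_mapping_eq_iff[of "H u"] fun_eq_iff lookup_H H_NE_eq_iff H_SE_eq_iff)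
next
  assume H: "H u = H v"
  \<comment> \<open>Equal vertex counts and equal net crossings make \<open>d\<close> change only
    its sign from one height to the next, so a single zero propagates upwards.\<close>
  define d where "d k = int (steps U u k) - int (steps U v k)" for k
  \<comment> \<open>A height below both paths, where all step counts vanish.\<close>
  define m where "m = - int (length u) - int (length v) - 1"
  have rec: "d (k + 1) = - d k" for k
  proof -
    have "int (steps U u k) - int (steps D u (k + 1)) = int (steps U v k) - int (steps D v (k + 1))"
      using assms by (simp add: steps_U_minus_steps_D)
    moreover have "int (steps U u (k + 1)) + int (steps D u (k + 1))
        = int (steps U v (k + 1)) + int (steps D v (k + 1))"
      using lookup_H[of u "k + 1"] lookup_H[of v "k + 1"] H assms by simp
    ultimately show ?thesis by (simp add: d_def)
  qed
  have "d k = 0" for k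
  proof (cases "m \<le> k")
    case True
    then show ?thesis
    proof (induction rule: int_ge_induct)
      case base
      show ?case by (simp add: d_def m_def steps_eq_0)
    qed (simp add: rec)
  qed (simp add: d_def m_def steps_eq_0)
  then show "H_NE u = H_NE v"
    by (simp add: H_NE_eq_iff d_def)
qed


section \<open>Balanced commutations and flips\<close>

lemma bal_equiv_refl [simp]: "bal_equiv u u"
  by (simp add: bal_equiv_def)

lemma bal_equiv_sym: "bal_equiv u v \<Longrightarrow> bal_equiv v u"
  using equivp_bal_equiv by (rule equivp_symp)

lemma bal_equiv_trans [trans]: "bal_equiv u v \<Longrightarrow> bal_equiv v w \<Longrightarrow> bal_equiv u w"
  using equivp_bal_equiv by (rule equivp_transp)

lemma bal_step_Cons: "bal_step u v \<Longrightarrow> bal_step (a # u) (a # v)"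
  by (erule bal_step.cases) (metis append_Cons bal_step.intros)

lemma bal_equiv_Cons: "bal_equiv u v \<Longrightarrow> bal_equiv (a # u) (a # v)"
  unfolding bal_equiv_def
  by (induction rule: rtranclp_induct) (auto intro: bal_step_Cons rtranclp.rtrancl_into_rtrancl)

lemma bal_equiv_length: "bal_equiv u v \<Longrightarrow> length u = length v"
  unfolding bal_equiv_def by (induction rule: rtranclp_induct) (auto elim!: bal_step.cases)

lemma flip_equiv_trans [trans]: "flip_equiv u v \<Longrightarrow> flip_equiv v w \<Longrightarrow> flip_equiv u w"
  using equivp_flip_equiv by (rule equivp_transp)

lemma flip_equiv_omega: "balanced x \<Longrightarrow> flip_equiv (p @ omega x @ q) (p @ x @ q)"
  unfolding flip_equiv_def by (intro r_into_rtranclp flip_step.intros)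

section \<open>Commutations as composites of flips, and invariants of flips\<close>

lemma omega_append: "omega (v @ w) = omega w @ omega v"
  by (simp add: omega_def)

text \<open>Flipping \<open>y @ x\<close> as one block reverses the order of its factors; flipping
  each factor back leaves them interchanged.\<close>

lemma bal_step_imp_flip_equiv: "bal_step u v \<Longrightarrow> flip_equiv u v"
proof (induction rule: bal_step.induct)
  case (1 x y p q)
  have "flip_equiv (p @ y @ x @ q) (p @ omega x @ omega y @ q)"
    using flip_equiv_omega[of "omega (y @ x)" p q] 1
    by (simp add: balanced_iff_final_height omega_append)
  also have "flip_equiv \<dots> (p @ x @ omega y @ q)"
    using flip_equiv_omega[OF 1(1), of p "omega y @ q"] by simp
  also have "flip_equiv \<dots> (p @ x @ y @ q)"
    using flip_equiv_omega[OF 1(2), of "p @ x" q] by simp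
  finally show ?case .
qed

lemma bal_equiv_imp_flip_equiv: "bal_equiv u v \<Longrightarrow> flip_equiv u v"
  unfolding bal_equiv_def
proof (induction rule: rtranclp_induct)
  case base
  show ?case by (simp add: flip_equiv_def)
qed (blast intro: flip_equiv_trans bal_step_imp_flip_equiv)

lemma flip_step_invariants:
  "flip_step u v \<Longrightarrow> final_height u = final_height v \<and> H_SE u = H_SE v"
proof (induction rule: flip_step.induct)
  case (1 x p q)
  \<comment> \<open>By \<open>steps_omega\<close> the left side counts the up steps of
    \<open>x\<close> from \<open>k - 1\<close>; a balanced path crosses the gap below
    \<open>k\<close> equally often in both directions.\<close>
  have "steps D (omega x) k = steps D x k" for k
    using 1 steps_U_minus_steps_D[of x "k - 1"]
    by (simp add: steps_omega balanced_iff_final_height)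
  with 1 show ?case
    by (simp add: H_SE_eq_iff steps_append balanced_iff_final_height)
qed

lemma flip_equiv_invariants:
  "flip_equiv u v \<Longrightarrow> final_height u = final_height v \<and> H_SE u = H_SE v"
  unfolding flip_equiv_def
  by (induction rule: rtranclp_induct) (auto dest: flip_step_invariants)

section \<open>Bringing a chosen letter to the front\<close>

lemma return_to_zero:
  assumes i: "i < length w" "height w i = 0"
    and sign: "slope (w ! i) * final_height w \<le> 0"
  obtains j where "i < j" "j \<le> length w" "height w j = 0"
proof -
  define s where "s = slope (w ! i)"
  have s: "s * s = 1"
    by (cases "w ! i") (simp_all add: s_def)
  \<comment> \<open>The step leaves height 0 on the side of sign \<open>s\<close>, while the path
    ends at 0 or on the opposite side. The factor \<open>- s\<close> orients this so that the
    discrete intermediate value theorem applies after the step.\<close>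
  define f where "f j = - s * height w j" for j
  have "\<bar>f (Suc j) - f j\<bar> \<le> 1" if "j < length w" for j
  proof -
    have "f (Suc j) - f j = - s * slope (w ! j)"
      using height_Suc[OF that] by (simp add: f_def algebra_simps)
    then show ?thesis
      unfolding s_def by (cases "w ! i"; cases "w ! j") simp_all
  qed
  moreover have "f (Suc i) \<le> 0"
    using height_Suc[OF i(1)] i(2) s by (simp add: f_def flip: s_def)
  moreover have "0 \<le> f (length w)"
    using sign by (simp add: f_def s_def final_height_def)
  ultimately obtain j where j: "Suc i \<le> j" "j \<le> length w" "f j = 0"
    using nat_intermed_int_val[of "Suc i" "length w" f 0] Suc_leI[OF i(1)] by blast
  have "height w j = 0"
    using j(3) s by (auto simp: f_def)
  with j(1,2) show thesis
    by (intro that[of j]) simp_all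
qed

text \<open>Cut the path at a \<open>b\<close> step from height 0 and at a later return to 0. The
  two pieces \<open>x\<close> and \<open>y\<close> are balanced, and \<open>y\<close> begins with
  \<open>b\<close>, so interchanging them suffices.\<close>

lemma bal_equiv_to_front:
  assumes "steps b w 0 > 0" "slope b * final_height w \<le> 0"
  obtains r where "bal_equiv w (b # r)"
proof -
  obtain i where i: "i < length w" "w ! i = b" "height w i = 0"
    using steps_posD[OF assms(1)] .
  obtain j where j: "i < j" "j \<le> length w" "height w j = 0"
    using return_to_zero[of i w] i assms(2) by auto
  define x where "x = take i w"
  define y where "y = drop i (take j w)"
  have xy: "x @ y = take j w"
    using j(1) append_take_drop_id[of i "take j w"] by (simp add: x_def y_def min_def)
  then have w: "w = x @ y @ drop j w"
    by (metis append.assoc append_take_drop_id)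
  have "final_height x = 0" "final_height (x @ y) = 0"
    using i(3) j(3) unfolding xy by (simp_all add: x_def height_eq_final_height)
  then have "bal_step ([] @ x @ y @ drop j w) ([] @ y @ x @ drop j w)"
    by (intro bal_step.intros) (simp_all add: balanced_iff_final_height)
  then have "bal_equiv w (y @ x @ drop j w)"
    using w by (simp add: bal_equiv_def)
  moreover have "y = b # tl y"
    using i j by (simp add: y_def drop_take Cons_nth_drop_Suc[symmetric] take_Cons')
  ultimately show thesis
    using that[of "tl y @ x @ drop j w"] by (metis append_Cons)
qed

lemma bal_equiv_invariants:
  assumes "bal_equiv u v"
  shows "final_height u = final_height v" "steps a u k = steps a v k"
proof -
  have *: "final_height u = final_height v" "H_SE u = H_SE v"
    using flip_equiv_invariants[OF bal_equiv_imp_flip_equiv[OF assms]] by auto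
  then have "H_NE u = H_NE v"
    using H_NE_eq_iff_H_SE_eq by blast
  with * show "final_height u = final_height v" "steps a u k = steps a v k"
    by (cases a; simp add: H_NE_eq_iff H_SE_eq_iff)+
qed

text \<open>Induction on the length: once both words begin with the same letter, deleting it shifts
  all heights alike and preserves equality of the counts.\<close>

lemma steps_eq_imp_bal_equiv:
  assumes "final_height u = final_height v" "\<And>a k. steps a u k = steps a v k"
  shows "bal_equiv u v"
  using assms
proof (induction "length u" arbitrary: u v rule: less_induct)
  case less
  have eq_first: "bal_equiv (a # u') (a # v')"
    if "length u' < length u" "final_height (a # u') = final_height (a # v')"
      "\<And>b k. steps b (a # u') k = steps b (a # v') k" for a u' v'
  proof (intro bal_equiv_Cons less.hyps)
    fix b k
    show "steps b u' k = steps b v' k"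
      using that(3)[of b "k + slope a"] by simp
  qed (use that in simp_all)
  show ?case
  proof (cases u)
    case Nil
    have "v = []"
    proof (cases v)
      case (Cons b v')
      then show ?thesis using less.prems(2)[of b 0] Nil by simp
    qed
    with Nil show ?thesis by simp
  next
    case u: (Cons a u')
    then have "v \<noteq> []" using less.prems(2)[of a 0] by auto
    then obtain b v' where v: "v = b # v'" by (cases v) auto
    \<comment> \<open>The first letter of each word is a step from height 0, so equal counts provide
      such a step in the other word as well.\<close>
    have pos: "steps b u 0 > 0" "steps a v 0 > 0"
      using less.prems(2)[of b 0] v less.prems(2)[of a 0, symmetric] u by (simp, simp)
    show ?thesis
    proof (cases "a = b")
      case True
      then show ?thesis using eq_first[of u' a v'] less.prems u v by simp
    next
      case False
      then have ab: "slope a = - slope b"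
        by (simp add: letter_neq_iff)
      show ?thesis
      \<comment> \<open>The slopes of \<open>a\<close> and \<open>b\<close> are opposite and the
        final heights agree, so the sign condition of \<open>bal_equiv_to_front\<close> holds for
        \<open>b\<close> in \<open>u\<close> or for \<open>a\<close> in \<open>v\<close>.\<close>
      proof (cases "slope b * final_height u \<le> 0")
        case True
        then obtain r where r: "bal_equiv u (b # r)"
          using bal_equiv_to_front pos(1) by blast
        note inv = bal_equiv_invariants[OF r]
        have "length r < length u"
          using bal_equiv_length[OF r] by simp
        then have "bal_equiv (b # r) (b # v')"
          using eq_first[of r b v'] inv less.prems v by simp
        with r v show ?thesis by (blast intro: bal_equiv_trans)
      next
        case False
        then have "slope a * final_height v \<le> 0"
          using ab less.prems(1) by simp
        then obtain r where r: "bal_equiv v (a # r)"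
          using bal_equiv_to_front pos(2) by blast
        note inv = bal_equiv_invariants[OF r]
        have "bal_equiv (a # u') (a # r)"
          using eq_first[of u' a r] inv less.prems u by simp
        with r u show ?thesis by (blast intro: bal_equiv_trans bal_equiv_sym)
      qed
    qed
  qed
qed


section \<open>The action on monomials\<close>

lemma weyl_act_phi: "weyl_act (phi w) p = word_act w p"
proof (induction w)
  case (Cons a w)
  then show ?case
    by (cases a) (simp_all add: phi_def word_act_def weyl_act_mult weyl_act_D weyl_act_U)
qed (simp add: phi_Nil weyl_act_1 word_act_def)

text \<open>The coefficient produced by \<open>w\<close> on \<open>x ^ n\<close>, as a polynomial in
  \<open>n\<close>: a \<open>D\<close> in front of \<open>w\<close> differentiates a monomial of
  exponent \<open>n + final_height w\<close>.\<close>

fun monom_factor :: "word \<Rightarrow> 'k::field_char_0 poly" where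
  "monom_factor [] = 1"
| "monom_factor (U # w) = monom_factor w"
| "monom_factor (D # w) = [:of_int (final_height w), 1:] * monom_factor w"

text \<open>With \<open>length w \<le> n\<close> no intermediate exponent is negative, so
  \<open>nat\<close> never truncates.\<close>

lemma word_act_monom:
  "length w \<le> n \<Longrightarrow> word_act w (monom 1 n) =
     monom (poly (monom_factor w) (of_nat n)) (nat (int n + final_height w))"
proof (induction w rule: monom_factor.induct)
  case 1
  then show ?case by (simp add: word_act_def)
next
  case (2 w)
  then have "nat (int n + final_height (U # w)) = Suc (nat (int n + final_height w))"
    using abs_final_height_le[of w] by simp
  with 2 show ?case by (simp add: word_act_def monom_Suc)
next
  case (3 w)
  define m where "m = nat (int n + final_height w)"
  have m: "int m = int n + final_height w"
    using 3 abs_final_height_le[of w] by (simp add: m_def)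
  have "of_int (final_height w) + of_nat n = (of_nat m :: 'a)"
    using arg_cong[OF m, of "of_int :: int \<Rightarrow> 'a"] by (simp add: add.commute)
  moreover have "nat (int n + final_height (D # w)) = m - 1"
    using m by simp
  ultimately show ?case
    using 3 by (simp add: word_act_def pderiv_monom flip: m_def distrib_right)
qed

text \<open>Each \<open>D\<close> contributes \<open>n\<close> plus the height of a suffix shorter
  than \<open>n\<close>, a positive integer, hence nonzero in characteristic 0.\<close>

lemma poly_monom_factor_neq_0:
  "length w \<le> n \<Longrightarrow> poly (monom_factor w) (of_nat n :: 'k::field_char_0) \<noteq> 0"
proof (induction w rule: monom_factor.induct)
  case (3 w)
  have "of_int (final_height w + int n) \<noteq> (0::'k)"
    using 3 abs_final_height_le[of w] by (subst of_int_eq_0_iff) auto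
  moreover have "poly (monom_factor (D # w)) (of_nat n :: 'k) =
      of_int (final_height w + int n) * poly (monom_factor w) (of_nat n)"
    by (simp add: algebra_simps)
  ultimately show ?case
    using 3 by (simp del: monom_factor.simps)
qed auto

lemma monom_factor_neq_0 [simp]: "(monom_factor w :: 'k::field_char_0 poly) \<noteq> 0"
  using poly_monom_factor_neq_0[of w "length w", where 'k = 'k] by auto

text \<open>The root \<open>- m\<close> arises once for each \<open>D\<close> followed by a suffix
  of final height \<open>m\<close>. Such a \<open>D\<close> ends at height
  \<open>final_height w - m\<close> and therefore starts one higher.\<close>

lemma order_monom_factor:
  "order (- of_int m :: 'k::field_char_0) (monom_factor w) = steps D w (final_height w - m + 1)"
proof (induction w rule: monom_factor.induct)
  case (3 w)
  have "order (- of_int m :: 'k) [:of_int (final_height w), 1:] = of_bool (final_height w = m)"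
  proof (cases "final_height w = m")
    case True
    then show ?thesis using order_power_n_n[of "- of_int m :: 'k" 1] by simp
  qed (auto intro!: order_0I)
  moreover have "[:of_int (final_height w), 1:] * monom_factor w \<noteq> (0 :: 'k poly)"
    by (simp only: mult_eq_0_iff) simp
  then have "order (- of_int m :: 'k) (monom_factor (D # w)) =
      order (- of_int m :: 'k) [:of_int (final_height w), 1:] +
      order (- of_int m :: 'k) (monom_factor w)"
    unfolding monom_factor.simps by (rule order_mult)
  ultimately show ?case
    using 3 by (auto simp: algebra_simps simp del: monom_factor.simps)
qed (auto simp: algebra_simps)

text \<open>Degrees of the images of large monomials give the final height. The coefficients then
  agree at infinitely many \<open>n\<close>, so the factor polynomials coincide, and their root
  multiplicities are the down counts.\<close>

lemma weyl_act_eq_imp: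
  assumes "\<And>p :: 'k::field_char_0 poly. weyl_act (phi u) p = weyl_act (phi v) p"
  shows "final_height u = final_height v" "H_SE u = H_SE v"
proof -
  define m where "m = length u + length v"
  have eq: "monom (poly (monom_factor u) (of_nat n :: 'k)) (nat (int n + final_height u)) =
      monom (poly (monom_factor v) (of_nat n)) (nat (int n + final_height v))"
    if "m \<le> n" for n
    using that assms[of "monom 1 n"] by (simp add: weyl_act_phi word_act_monom m_def)
  have nz: "poly (monom_factor w) (of_nat n :: 'k) \<noteq> 0" if "length w \<le> m" "m \<le> n" for w n
    using that poly_monom_factor_neq_0[of w n] by simp
  have deg: "nat (int n + final_height u) = nat (int n + final_height v)" if "m \<le> n" for n
    using arg_cong[OF eq[OF that], of degree] nz[of u n] nz[of v n] that
    by (simp add: degree_monom_eq m_def)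
  show h: "final_height u = final_height v"
    using deg[of m] abs_final_height_le[of u] abs_final_height_le[of v] by (simp add: m_def)
  have "poly (monom_factor u - monom_factor v) (of_nat n :: 'k) = 0" if "m \<le> n" for n
    using eq[OF that] h by (metis coeff_monom diff_self poly_diff)
  then have "of_nat ` {m..} \<subseteq> {x :: 'k. poly (monom_factor u - monom_factor v) x = 0}"
    by auto
  moreover have "infinite (of_nat ` {m..} :: 'k set)"
    by (subst finite_image_iff) (auto simp: inj_on_def infinite_Ici)
  ultimately have "monom_factor u - monom_factor v = (0 :: 'k poly)"
    using poly_roots_finite finite_subset by blast
  then have "monom_factor u = (monom_factor v :: 'k poly)"
    by simp
  \<comment> \<open>This choice of root makes the height in \<open>order_monom_factor\<close> equal
    to \<open>k\<close>.\<close>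
  then show "H_SE u = H_SE v"
    using order_monom_factor[where 'k = 'k, of "final_height u - k + 1" u for k]
      order_monom_factor[where 'k = 'k, of "final_height u - k + 1" v for k] h
    by (simp add: H_SE_eq_iff)
qed


section \<open>Commutation of balanced words in the Weyl algebra\<close>

text \<open>The integer polynomials in \<open>U D\<close>; closure under differences also supplies
  0, negatives and sums.\<close>

inductive_set UD_ring :: "'k::field weyl set" where
  one: "1 \<in> UD_ring"
| gen: "weyl_gen U * weyl_gen D \<in> UD_ring"
| diff: "a \<in> UD_ring \<Longrightarrow> b \<in> UD_ring \<Longrightarrow> a - b \<in> UD_ring"
| mult: "a \<in> UD_ring \<Longrightarrow> b \<in> UD_ring \<Longrightarrow> a * b \<in> UD_ring"

lemma UD_ring_add: "a \<in> UD_ring \<Longrightarrow> b \<in> UD_ring \<Longrightarrow> a + b \<in> UD_ring"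
  using UD_ring.diff[OF _ UD_ring.diff[OF UD_ring.diff[OF UD_ring.one UD_ring.one]], of a b] by simp

lemma weyl_DU: "weyl_gen D * weyl_gen U = (weyl_gen U * weyl_gen D + 1 :: 'k::field weyl)"
  using weyl_commutation by (metis add.commute diff_add_cancel)

lemma UD_ring_commute_gen:
  "a \<in> UD_ring \<Longrightarrow> a * (weyl_gen U * weyl_gen D) = weyl_gen U * weyl_gen D * a"
proof (induction rule: UD_ring.induct)
  case (mult a b)
  then show ?case by (metis mult.assoc)
qed (simp_all add: algebra_simps)

lemma UD_ring_commute: "a \<in> UD_ring \<Longrightarrow> b \<in> UD_ring \<Longrightarrow> a * b = b * a"
proof (induction rule: UD_ring.induct)
  case gen
  then show ?case by (simp add: UD_ring_commute_gen)
next
  case (mult a a')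
  then show ?case by (metis mult.assoc)
qed (simp_all add: algebra_simps)

text \<open>Moving a letter to the right past \<open>U D\<close> turns it into
  \<open>U D - 1\<close> for \<open>U\<close> and \<open>U D + 1\<close> for \<open>D\<close>;
  differences and products follow.\<close>

lemma letter_past_UD_ring:
  "a \<in> UD_ring \<Longrightarrow> \<exists>b\<in>UD_ring. weyl_gen l * a = b * (weyl_gen l :: 'k::field weyl)"
proof (induction rule: UD_ring.induct)
  case one
  show ?case by (auto intro: bexI[of _ 1] UD_ring.one)
next
  case gen
  show ?case
  proof (cases l)
    case U
    have "weyl_gen U * (weyl_gen U * weyl_gen D) =
        (weyl_gen U * weyl_gen D - 1) * (weyl_gen U :: 'k weyl)"
      by (simp add: left_diff_distrib mult.assoc weyl_DU distrib_left)
    with U show ?thesis by (auto intro: UD_ring.intros)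
  next
    case D
    have "weyl_gen D * (weyl_gen U * weyl_gen D) =
        (weyl_gen U * weyl_gen D + 1) * (weyl_gen D :: 'k weyl)"
      by (simp add: weyl_DU flip: mult.assoc)
    with D show ?thesis by (auto intro: UD_ring.intros UD_ring_add)
  qed
next
  case (diff a b)
  then show ?case by (metis UD_ring.diff left_diff_distrib right_diff_distrib)
next
  case (mult a b)
  then show ?case by (metis UD_ring.mult mult.assoc)
qed

lemma letter_swap_UD_ring: "weyl_gen l * weyl_gen (swap_letter l) \<in> UD_ring"
  by (cases l) (auto simp: weyl_DU intro: UD_ring.intros UD_ring_add)

text \<open>A new letter first passes the ring element. It then extends the power behind it, or
  pairs with one opposite letter to form \<open>U D\<close> or \<open>D U\<close>, which the ring
  absorbs.\<close>

lemma phi_normal_form: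
  "\<exists>a\<in>UD_ring. \<exists>l n. final_height w = slope l * int n \<and>
     phi w = a * (weyl_gen l ^ n :: 'k::field weyl)"
proof (induction w)
  case Nil
  then show ?case
    by (intro bexI[of _ 1] exI[of _ U] exI[of _ 0]) (auto simp: phi_Nil intro: UD_ring.one)
next
  case (Cons c w)
  then obtain a l n where a: "a \<in> UD_ring" and h: "final_height w = slope l * int n"
    and w: "phi w = a * (weyl_gen l ^ n :: 'k weyl)" by blast
  obtain b where b: "b \<in> UD_ring" "weyl_gen c * a = b * (weyl_gen c :: 'k weyl)"
    using letter_past_UD_ring[OF a] by blast
  have cw: "phi (c # w) = b * weyl_gen c * weyl_gen l ^ n"
    using w b(2) by (simp add: phi_def flip: mult.assoc)
  consider "n = 0" | "c = l" | m where "c \<noteq> l" "n = Suc m"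
    by (cases n) auto
  then show ?case
  proof cases
    \<comment> \<open>With exponent 0 the old \<open>l\<close> carries no information, so the new
      letter takes its place with exponent 1.\<close>
    case 1
    then show ?thesis using cw h b(1)
      by (intro bexI[of _ b] exI[of _ c] exI[of _ 1]) auto
  next
    case 2
    then show ?thesis using cw h b(1)
      by (intro bexI[of _ b] exI[of _ c] exI[of _ "Suc n"]) (auto simp: algebra_simps)
  next
    case 3
    then have l: "l = swap_letter c"
      by (metis letter_neq_iff)
    have "phi (c # w) = (b * (weyl_gen c * weyl_gen l)) * weyl_gen l ^ m"
      using cw 3 by (simp add: mult.assoc)
    moreover have "b * (weyl_gen c * weyl_gen l) \<in> UD_ring"
      using b(1) letter_swap_UD_ring l by (auto intro: UD_ring.mult)
    moreover have "final_height (c # w) = slope l * int m"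
      using h 3 l by (simp add: algebra_simps)
    ultimately show ?thesis by blast
  qed
qed

lemma phi_balanced_in_UD_ring:
  assumes "balanced w"
  shows "(phi w :: 'k::field weyl) \<in> UD_ring"
proof -
  obtain a l n where a: "a \<in> UD_ring" and n: "final_height w = slope l * int n"
    and w: "phi w = a * (weyl_gen l ^ n :: 'k weyl)"
    using phi_normal_form by blast
  have "n = 0"
    using assms n by (cases l) (auto simp: balanced_iff_final_height)
  with a w show ?thesis by simp
qed

lemma bal_step_imp_phi_eq: "bal_step u v \<Longrightarrow> phi u = phi v"
proof (induction rule: bal_step.induct)
  case (1 x y p q)
  then have "phi x * phi y = phi y * phi x"
    by (intro UD_ring_commute phi_balanced_in_UD_ring)
  then show ?case by (metis phi_append append.assoc)
qed

lemma bal_equiv_imp_phi_eq: "bal_equiv u v \<Longrightarrow> phi u = phi v"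
  unfolding bal_equiv_def by (induction rule: rtranclp_induct) (auto dest: bal_step_imp_phi_eq)

theorem theorem2p1:
  fixes u v :: word
  shows "((phi u :: 'k::field_char_0 weyl) = phi v \<longleftrightarrow>
            (\<forall>p :: 'k poly. weyl_act (phi u) p = weyl_act (phi v) p))
       \<and> ((phi u :: 'k weyl) = phi v \<longleftrightarrow> final_height u = final_height v \<and> H_NE u = H_NE v)
       \<and> ((phi u :: 'k weyl) = phi v \<longleftrightarrow> final_height u = final_height v \<and> H_SE u = H_SE v)
       \<and> ((phi u :: 'k weyl) = phi v \<longleftrightarrow> final_height u = final_height v \<and> H u = H v)
       \<and> ((phi u :: 'k weyl) = phi v \<longleftrightarrow> bal_equiv u v)
       \<and> ((phi u :: 'k weyl) = phi v \<longleftrightarrow> flip_equiv u v)"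
proof -
  let ?S1 = "(phi u :: 'k weyl) = phi v"
  let ?S2 = "\<forall>p :: 'k poly. weyl_act (phi u) p = weyl_act (phi v) p"
  let ?h = "final_height u = final_height v"
  \<comment> \<open>The implications close two cycles through the down counts: via the action,
    commutations and back to \<open>phi\<close>, and from commutations via flips. The other two
    height polynomials are tied in by equivalences.\<close>
  have S12: "?S1 \<Longrightarrow> ?S2" by simp
  have S23: "?S2 \<Longrightarrow> ?h \<and> H_SE u = H_SE v"
    using weyl_act_eq_imp[where 'k = 'k] by blast
  have NE_SE: "?h \<and> H_NE u = H_NE v \<longleftrightarrow> ?h \<and> H_SE u = H_SE v"
    using H_NE_eq_iff_H_SE_eq by blast
  have NE_H: "?h \<and> H_NE u = H_NE v \<longleftrightarrow> ?h \<and> H u = H v"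
    using H_NE_eq_iff_H_eq by blast
  have S35: "bal_equiv u v" if "?h \<and> H_SE u = H_SE v"
  proof (rule steps_eq_imp_bal_equiv)
    fix a k
    have "H_NE u = H_NE v" using that NE_SE by blast
    then show "steps a u k = steps a v k"
      using that by (cases a) (simp_all add: H_NE_eq_iff H_SE_eq_iff)
  qed (use that in blast)
  have S51: "bal_equiv u v \<Longrightarrow> ?S1" by (rule bal_equiv_imp_phi_eq)
  have S56: "bal_equiv u v \<Longrightarrow> flip_equiv u v" by (rule bal_equiv_imp_flip_equiv)
  have S63: "flip_equiv u v \<Longrightarrow> ?h \<and> H_SE u = H_SE v" by (rule flip_equiv_invariants)
  show ?thesis
    using S12 S23 NE_SE NE_H S35 S51 S56 S63 by argo
qed

end
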